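(* Let $\mathcal{T}_{\mathbf{a}}$ be a label-regular tree with labelling $\lambda: V\mathcal{T}_{\mathbf{a}}\to C$, let $v\in V\mathcal{T}_{\mathbf{a}}$ be a fixed vertex and let $K=\{g\in \mathrm{Aut}(\mathcal{T}_{\mathbf{a}}) : g(v)=v\}$. Let $A$ be the set of all finite sequences in $C$ that are compatible with $\mathcal{T}_{\mathbf{a}}$ and that begin and end with the label $\lambda(v)$. For each $\alpha\in A$ choose $v_\alpha\in V\mathcal{T}_{\mathbf{a}}$ and $g_\alpha\in\mathrm{Aut}(\mathcal{T}_{\mathbf{a}})$ such that the sequence of labels of the vertices on the unique path from $v$ to $v_\alpha$ is $\alpha$ and $g_\alpha(v)=v_\alpha$. Then the double cosets $Kg_\alpha K$, $\alpha\in A$, are pairwise disjoint and $$\mathrm{Aut}(\mathcal{T}_{\mathbf{a}})=\bigsqcup_{\alpha\in A}Kg_\alpha K.$$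
   Context: All trees are infinite, locally finite, and all vertices have degree greater than $1$. $V\mathcal{T}$ is the vertex set of a tree $\mathcal{T}$. A path is a sequence of pairwise distinct vertices $(v_i)_{i\in I}$ with $v_i$ adjacent to $v_{i+1}$ for all $i$ (a single vertex is a path). A labelling of a tree $\mathcal{T}$ is a map $\lambda:V\mathcal{T}\to C$ to a set $C$ of labels. The labelled tree is label-regular if for each vertex $v$ the multiset of labels of the neighbours of $v$ depends only on $\lambda(v)$. Then, for $i,j\in C$, $a_{ij}$ denotes the number of neighbours labelled $j$ of any vertex labelled $i$, and $\mathbf{a}=(a_{ij})_{i,j\in C}$; the tree is determined up to (label-preserving) isomorphism by $\mathbf{a}$ and is denoted $\mathcal{T}_{\mathbf{a}}$. $\mathrm{Aut}(\mathcal{T}_{\mathbf{a}})$ is the group of all automorphisms $\varphi$ of the underlying tree with $\lambda(\varphi(v))=\lambda(v)$ for all vertices $v$. All labellings are assumed normal: $\lambda$ is surjective and $\mathrm{Aut}(\mathcal{T}_{\mathbf{a}})$ is transitive on each set $\lambda^{-1}(i)$, $i\in C$. A sequence of labels $(c_i)_{i\in I}\subseteq C$ is compatible with $\mathcal{T}_{\mathbf{a}}$ if there is a path $(v_i)_{i\in I}$ in $\mathcal{T}_{\mathbf{a}}$ with $\lambda(v_i)=c_i$ for every $i\in I$. *)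

theory Defs
  imports "HOL-Algebra.Bij" "HOL-Algebra.Coset" "HOL-Library.Multiset" "HOL-Library.Disjoint_Sets"
begin

definition nbrs :: "'v set \<Rightarrow> ('v \<Rightarrow> 'v \<Rightarrow> bool) \<Rightarrow> 'v \<Rightarrow> 'v set" where
  "nbrs V E u = {w \<in> V. E u w}"

definition is_path :: "'v set \<Rightarrow> ('v \<Rightarrow> 'v \<Rightarrow> bool) \<Rightarrow> 'v list \<Rightarrow> bool" where
  "is_path V E p \<longleftrightarrow> p \<noteq> [] \<and> set p \<subseteq> V \<and> distinct p \<and> successively E p"

definition is_path_between :: "'v set \<Rightarrow> ('v \<Rightarrow> 'v \<Rightarrow> bool) \<Rightarrow> 'v \<Rightarrow> 'v list \<Rightarrow> 'v \<Rightarrow> bool" where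
  "is_path_between V E u p w \<longleftrightarrow> is_path V E p \<and> hd p = u \<and> last p = w"

definition is_cycle :: "'v set \<Rightarrow> ('v \<Rightarrow> 'v \<Rightarrow> bool) \<Rightarrow> 'v list \<Rightarrow> bool" where
  "is_cycle V E p \<longleftrightarrow> is_path V E p \<and> 3 \<le> length p \<and> E (last p) (hd p)"

locale graph_tree =
  fixes V :: "'v set" and E :: "'v \<Rightarrow> 'v \<Rightarrow> bool"
  assumes adj_in_V: "E u w \<Longrightarrow> u \<in> V \<and> w \<in> V"
    and adj_sym: "E u w \<Longrightarrow> E w u"
    and adj_irrefl: "\<not> E u u"
    and nonempty: "V \<noteq> {}"
    and connected: "u \<in> V \<Longrightarrow> w \<in> V \<Longrightarrow> \<exists>p. is_path_between V E u p w"
    and acyclic: "\<not> is_cycle V E p"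

text \<open>Standing assumptions on all trees: infinite, locally finite, every degree greater than 1.\<close>

locale inf_lf_tree = graph_tree +
  assumes infinite_V: "infinite V"
    and locally_finite: "u \<in> V \<Longrightarrow> finite (nbrs V E u)"
    and degree_gt_1: "u \<in> V \<Longrightarrow> card (nbrs V E u) > 1"

text \<open>Meaningful in a tree, where the path from \<open>u\<close> to \<open>w\<close> is unique.\<close>

definition tree_path :: "'v set \<Rightarrow> ('v \<Rightarrow> 'v \<Rightarrow> bool) \<Rightarrow> 'v \<Rightarrow> 'v \<Rightarrow> 'v list" where
  "tree_path V E u w = (THE p. is_path_between V E u p w)"

definition label_regular :: "'v set \<Rightarrow> ('v \<Rightarrow> 'v \<Rightarrow> bool) \<Rightarrow> ('v \<Rightarrow> 'c) \<Rightarrow> bool" where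
  "label_regular V E lab \<longleftrightarrow>
     (\<forall>u\<in>V. \<forall>w\<in>V. lab u = lab w \<longrightarrow>
        image_mset lab (mset_set (nbrs V E u)) = image_mset lab (mset_set (nbrs V E w)))"

text \<open>
  \<open>Bij V\<close> consists of the bijections of \<open>V\<close> that are \<open>undefined\<close> outside \<open>V\<close>, so distinct
  elements of the automorphism group are distinct as maps on the vertex set.
\<close>

definition label_auts :: "'v set \<Rightarrow> ('v \<Rightarrow> 'v \<Rightarrow> bool) \<Rightarrow> ('v \<Rightarrow> 'c) \<Rightarrow> ('v \<Rightarrow> 'v) set" where
  "label_auts V E lab =
     {f \<in> Bij V. (\<forall>u\<in>V. \<forall>w\<in>V. E (f u) (f w) \<longleftrightarrow> E u w) \<and> (\<forall>u\<in>V. lab (f u) = lab u)}"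

definition label_aut_group ::
    "'v set \<Rightarrow> ('v \<Rightarrow> 'v \<Rightarrow> bool) \<Rightarrow> ('v \<Rightarrow> 'c) \<Rightarrow> ('v \<Rightarrow> 'v) monoid" where
  "label_aut_group V E lab = BijGroup V\<lparr>carrier := label_auts V E lab\<rparr>"

definition normal_labelling ::
    "'v set \<Rightarrow> ('v \<Rightarrow> 'v \<Rightarrow> bool) \<Rightarrow> ('v \<Rightarrow> 'c) \<Rightarrow> 'c set \<Rightarrow> bool" where
  "normal_labelling V E lab C \<longleftrightarrow>
     lab ` V = C \<and>
     (\<forall>i\<in>C. \<forall>u\<in>V. \<forall>w\<in>V. lab u = i \<longrightarrow> lab w = i \<longrightarrow>
        (\<exists>g\<in>carrier (label_aut_group V E lab). g u = w))"

text \<open>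
  The matrix \<open>a\<close> of numbers of neighbours is determined by the labelled tree and is not carried
  along as a separate parameter.
\<close>

locale label_regular_tree = inf_lf_tree V E
  for V :: "'v set" and E :: "'v \<Rightarrow> 'v \<Rightarrow> bool" +
  fixes lab :: "'v \<Rightarrow> 'c" and C :: "'c set"
  assumes regular: "label_regular V E lab"
    and normal: "normal_labelling V E lab C"

definition compatible :: "'v set \<Rightarrow> ('v \<Rightarrow> 'v \<Rightarrow> bool) \<Rightarrow> ('v \<Rightarrow> 'c) \<Rightarrow> 'c list \<Rightarrow> bool" where
  "compatible V E lab cs \<longleftrightarrow> (\<exists>p. is_path V E p \<and> map lab p = cs)"

definition loop_label_seqs ::
    "'v set \<Rightarrow> ('v \<Rightarrow> 'v \<Rightarrow> bool) \<Rightarrow> ('v \<Rightarrow> 'c) \<Rightarrow> 'c set \<Rightarrow> 'v \<Rightarrow> 'c list set" where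
  "loop_label_seqs V E lab C v =
     {\<alpha>. set \<alpha> \<subseteq> C \<and> compatible V E lab \<alpha> \<and> \<alpha> \<noteq> [] \<and> hd \<alpha> = lab v \<and> last \<alpha> = lab v}"

text \<open>\<open>(w, g)\<close> is an admissible choice of \<open>(v\<^sub>\<alpha>, g\<^sub>\<alpha>)\<close>.\<close>

definition admissible_choice ::
    "'v set \<Rightarrow> ('v \<Rightarrow> 'v \<Rightarrow> bool) \<Rightarrow> ('v \<Rightarrow> 'c) \<Rightarrow> 'v \<Rightarrow> 'c list \<Rightarrow> 'v \<Rightarrow> ('v \<Rightarrow> 'v) \<Rightarrow> bool" where
  "admissible_choice V E lab v \<alpha> w g \<longleftrightarrow>
     w \<in> V \<and> g \<in> carrier (label_aut_group V E lab) \<and>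
     map lab (tree_path V E v w) = \<alpha> \<and> g v = w"

definition double_coset :: "('g, 'm) monoid_scheme \<Rightarrow> 'g set \<Rightarrow> 'g \<Rightarrow> 'g set" where
  "double_coset G K g = K <#>\<^bsub>G\<^esub> {g} <#>\<^bsub>G\<^esub> K"

end

theory Submission
  imports Defs
begin

text \<open>
  Write \<open>\<tau> h\<close> for the sequence of labels along the path from \<open>v\<close> to \<open>h v\<close>. The decomposition
  holds because \<open>\<tau>\<close> is a complete invariant of the double coset \<open>K h K\<close>, and the values of
  \<open>\<tau>\<close> on the automorphism group are exactly the sequences in \<open>A\<close>
  (\<open>label_path_in_loop_label_seqs\<close> and \<open>loop_label_seq_realised\<close>). Hence the
  double cosets are the fibres of \<open>\<tau>\<close>, and they are indexed by \<open>A\<close>.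

  Invariance is easy: \<open>(k g k') v = k (g v)\<close>, and \<open>k\<close> carries the path from \<open>v\<close> to \<open>g v\<close>
  to the path from \<open>v\<close> to \<open>k (g v)\<close> without changing labels. Completeness amounts to
  the statement that two paths from \<open>v\<close> with the same label sequence differ by an element \<open>k\<close>
  of \<open>K\<close>: if \<open>k (g v) = h v\<close>, then \<open>(k g)\<inverse> h\<close> fixes \<open>v\<close>, so \<open>h\<close> lies in
  \<open>k g K\<close>.

  The element \<open>k\<close> is constructed in \<open>label_aut_mapping_path\<close>. Matching the two paths vertex by
  vertex is an isomorphism between two finite subtrees. Any isomorphism between subtrees can be
  enlarged as long as its domain is not the whole tree: a new vertex adjacent to the domain is sent
  to an unused neighbour with the same label, which exists by label-regularity, and since a tree has
  no cycles no further adjacency has to be respected. Zorn's lemma gives a maximal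
  extension, whose domain is therefore the whole tree; the same argument applied to the inverse shows
  that it is onto.
\<close>

section \<open>Paths in trees\<close>

lemma exists_edge_leaving:
  assumes "successively E p" "p \<noteq> []" "hd p \<in> D" "last p \<notin> D"
  obtains a b where "a \<in> D" "b \<notin> D" "E a b"
proof -
  have "\<exists>a b. a \<in> D \<and> b \<notin> D \<and> E a b"
    using assms
  proof (induction p)
    case (Cons x p)
    show ?case
    proof (cases "p \<noteq> [] \<and> hd p \<in> D")
      case True
      then show ?thesis
        using Cons by (auto simp: successively_Cons)
    next
      case False
      then show ?thesis
        using Cons.prems by (cases p) auto
    qed
  qed simp
  then show thesis
    using that by blast
qed

text \<open>In a tree, the nonempty sets of vertices with this property are the vertex sets of subtrees.\<close>

definition path_connected_in :: "('v \<Rightarrow> 'v \<Rightarrow> bool) \<Rightarrow> 'v set \<Rightarrow> bool" where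
  "path_connected_in E D \<longleftrightarrow> (\<forall>u\<in>D. \<forall>w\<in>D. \<exists>p. is_path_between D E u p w)"

lemma is_path_between_mono:
  "is_path_between D E u p w \<Longrightarrow> D \<subseteq> D' \<Longrightarrow> is_path_between D' E u p w"
  by (auto simp: is_path_between_def is_path_def)

text \<open>The form of connectedness of a directed union that applies to chains of subtrees.\<close>

lemma path_connected_in_Union:
  assumes "\<And>u w. u \<in> \<Union>S \<Longrightarrow> w \<in> \<Union>S \<Longrightarrow> \<exists>D\<in>S. path_connected_in E D \<and> u \<in> D \<and> w \<in> D"
  shows "path_connected_in E (\<Union>S)"
  unfolding path_connected_in_def
proof (intro ballI)
  fix u w assume "u \<in> \<Union>S" "w \<in> \<Union>S"
  then obtain D where D: "D \<in> S" "path_connected_in E D" "u \<in> D" "w \<in> D"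
    using assms by blast
  then obtain p where "is_path_between D E u p w"
    unfolding path_connected_in_def by blast
  then show "\<exists>p. is_path_between (\<Union>S) E u p w"
    using is_path_between_mono D(1) by (metis Union_upper)
qed

context graph_tree
begin

lemma successively_flip_adj: "successively (\<lambda>x y. E y x) p \<longleftrightarrow> successively E p"
proof -
  have "(\<lambda>x y. E y x) = E"
    using adj_sym by blast
  then show ?thesis
    by (rule arg_cong[where f = "\<lambda>R. successively R p"])
qed

lemma is_path_between_rev:
  assumes "is_path_between D E u p w"
  shows "is_path_between D E w (rev p) u"
  using assms by (auto simp: is_path_between_def is_path_def hd_rev last_rev successively_flip_adj)

lemma path_connected_in_insert:
  assumes D: "path_connected_in E D" and w: "w \<in> D" and z: "z \<notin> D" and wz: "E w z"
  shows "path_connected_in E (insert z D)"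
proof -
  have to_z: "\<exists>p. is_path_between (insert z D) E u p z" if u: "u \<in> D" for u
  proof -
    obtain p where "is_path_between D E u p w"
      using D w u unfolding path_connected_in_def by blast
    then have "is_path_between (insert z D) E u (p @ [z]) z"
      using z wz by (auto simp: is_path_between_def is_path_def successively_append_iff)
    then show ?thesis
      by blast
  qed
  have to_self: "\<exists>p. is_path_between (insert z D) E z p z"
    by (rule exI[of _ "[z]"]) (simp add: is_path_between_def is_path_def)
  show ?thesis
    unfolding path_connected_in_def
  proof (intro ballI)
    fix u t assume "u \<in> insert z D" "t \<in> insert z D"
    then consider "u = z" "t = z" | "u \<in> D" "t = z" | "u = z" "t \<in> D" | "u \<in> D" "t \<in> D"
      by blast
    then show "\<exists>p. is_path_between (insert z D) E u p t"
    proof cases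
      case 3
      then show ?thesis
        using to_z is_path_between_rev by blast
    next
      case 4
      then show ?thesis
        using D is_path_between_mono[of D E u _ t "insert z D"]
        unfolding path_connected_in_def by blast
    qed (use to_z to_self in auto)
  qed
qed

text \<open>
  Two neighbours \<open>a\<close>, \<open>b\<close> of \<open>z\<close> are joined by a path inside \<open>D\<close>, and \<open>z\<close> would close it to a
  cycle. This is the only way in which acyclicity enters the extension of isomorphisms.
\<close>

lemma unique_neighbour_in_connected:
  assumes "path_connected_in E D" "D \<subseteq> V" "z \<notin> D" "a \<in> D" "b \<in> D" "E z a" "E z b"
  shows "a = b"
proof (rule ccontr)
  assume "a \<noteq> b"
  obtain p where p: "is_path_between D E a p b"
    using assms unfolding path_connected_in_def by blast
  then have "length p \<ge> 2"
    using \<open>a \<noteq> b\<close> by (cases p; cases "tl p") (auto simp: is_path_between_def is_path_def)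
  then have "is_cycle V E (z # p)"
    using p assms adj_sym adj_in_V
    by (auto simp: is_path_between_def is_path_def is_cycle_def successively_Cons)
  then show False
    using acyclic by blast
qed

text \<open>
  If two paths leave \<open>u\<close> through different vertices, then following the first one up to where
  it first meets the second and returning along the second gives a cycle. So they
  have the same second vertex, and induction applies.
\<close>

lemma path_between_unique:
  assumes "is_path_between V E u p w" "is_path_between V E u q w"
  shows "p = q"
  using assms
proof (induction p arbitrary: u q)
  case Nil
  then show ?case
    by (simp add: is_path_between_def is_path_def)
next
  case (Cons x p)
  then have x: "x = u" and p: "u \<notin> set p" "distinct p" "set p \<subseteq> V" "successively E (u # p)"
      "last (u # p) = w"
    by (auto simp: is_path_between_def is_path_def)
  obtain q' where q': "q = u # q'"
    using Cons.prems by (cases q) (auto simp: is_path_between_def is_path_def)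
  then have q: "u \<notin> set q'" "distinct q'" "set q' \<subseteq> V" "successively E (u # q')" "last (u # q') = w"
      "u \<in> V"
    using Cons.prems by (auto simp: is_path_between_def is_path_def)
  show ?case
  proof (cases "p = [] \<or> q' = []")
    case True
    then show ?thesis
      using p q x q' last_in_set by (metis last_ConsL last_ConsR)
  next
    case False
    then have ne: "p \<noteq> []" "q' \<noteq> []"
      by auto
    then have "last p \<in> set p" "last p \<in> set q'"
      using p(5) q(5) by (metis last_ConsR last_in_set)+
    then obtain xs y ys where xy: "p = xs @ y # ys" "y \<in> set q'" "\<forall>t\<in>set xs. t \<notin> set q'"
      using split_list_first_prop[of p "\<lambda>t. t \<in> set q'"] by blast
    obtain as bs where ab: "q' = as @ y # bs"
      using xy(2) by (meson split_list)
    \<comment> \<open>the cycle that arises unless both paths go from \<open>u\<close> directly to their meeting point \<open>y\<close>\<close>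
    let ?c = "u # xs @ y # rev as"
    have su: "successively E (y # rev as)"
      using q(4) successively_rev[of E "as @ [y]"] unfolding ab
      by (simp add: successively_Cons successively_append_iff successively_flip_adj)
    have "is_path V E ?c"
      using p q xy ab su
      by (auto simp: is_path_def successively_Cons successively_append_iff hd_append)
    moreover have "E (last ?c) u"
      using q(4) adj_sym unfolding ab by (cases as) (auto simp: successively_Cons last_rev)
    ultimately have "length ?c < 3"
      using acyclic unfolding is_cycle_def by (metis list.sel(1) not_le)
    then have "xs = []" "as = []"
      by auto
    then have hd: "hd p = y" "hd q' = y"
      using xy ab by auto
    have "is_path_between V E y p w" "is_path_between V E y q' w"
      using p q ne hd
      by (auto simp: is_path_between_def is_path_def successively_Cons)
    then show ?thesis
      using Cons.IH x q' by simp
  qed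
qed

lemma tree_path_eqI:
  assumes "is_path_between V E u p w"
  shows "tree_path V E u w = p"
  unfolding tree_path_def using assms path_between_unique by blast

lemma tree_path_is_path:
  assumes "u \<in> V" "w \<in> V"
  shows "is_path_between V E u (tree_path V E u w) w"
  using connected[OF assms] tree_path_eqI by metis

end

section \<open>Partial isomorphisms between subtrees\<close>

text \<open>
  Partial isomorphisms are given by their graphs, so that extension is set inclusion, limits of
  chains are unions and the inverse is the converse relation. The definition is symmetric in the two
  components; whatever is shown about domains transfers to ranges.
\<close>

definition partial_iso :: "'v set \<Rightarrow> ('v \<Rightarrow> 'v \<Rightarrow> bool) \<Rightarrow> ('v \<Rightarrow> 'c) \<Rightarrow> ('v \<times> 'v) set \<Rightarrow> bool" where
  "partial_iso V E lab F \<longleftrightarrow> F \<subseteq> V \<times> V \<and>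
     (\<forall>a a' b b'. (a, a') \<in> F \<longrightarrow> (b, b') \<in> F \<longrightarrow> (a = b \<longleftrightarrow> a' = b') \<and> (E a b \<longleftrightarrow> E a' b')) \<and>
     (\<forall>a a'. (a, a') \<in> F \<longrightarrow> lab a = lab a') \<and>
     path_connected_in E (Domain F) \<and> path_connected_in E (Range F)"

lemma partial_iso_converse: "partial_iso V E lab (F\<inverse>) \<longleftrightarrow> partial_iso V E lab F"
  unfolding partial_iso_def Domain_converse Range_converse converse_iff by (auto 4 4)

lemma partial_iso_Union_chain:
  assumes "subset.chain {F. partial_iso V E lab F} \<C>"
  shows "partial_iso V E lab (\<Union>\<C>)"
proof -
  have iso: "partial_iso V E lab X" if "X \<in> \<C>" for X
    using assms that by (auto simp: subset.chain_def)
  have common: "\<exists>X\<in>\<C>. x \<in> X \<and> y \<in> X" if x: "x \<in> \<Union>\<C>" and y: "y \<in> \<Union>\<C>" for x y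
  proof -
    obtain X Y where XY: "X \<in> \<C>" "Y \<in> \<C>" "x \<in> X" "y \<in> Y"
      using x y by blast
    then have "X \<subseteq> Y \<or> Y \<subseteq> X"
      using assms unfolding subset.chain_def by blast
    then show ?thesis
      using XY by blast
  qed
  have "path_connected_in E (\<Union>(Domain ` \<C>))"
  proof (rule path_connected_in_Union)
    fix u w assume "u \<in> \<Union>(Domain ` \<C>)" "w \<in> \<Union>(Domain ` \<C>)"
    then obtain u' w' where "(u, u') \<in> \<Union>\<C>" "(w, w') \<in> \<Union>\<C>"
      by blast
    then obtain X where "X \<in> \<C>" "(u, u') \<in> X" "(w, w') \<in> X"
      using common by blast
    then show "\<exists>D\<in>Domain ` \<C>. path_connected_in E D \<and> u \<in> D \<and> w \<in> D"
      using iso unfolding partial_iso_def by blast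
  qed
  then have "path_connected_in E (Domain (\<Union>\<C>))"
    by (simp add: Domain_Union)
  moreover have "path_connected_in E (\<Union>(Range ` \<C>))"
  proof (rule path_connected_in_Union)
    fix u w assume "u \<in> \<Union>(Range ` \<C>)" "w \<in> \<Union>(Range ` \<C>)"
    then obtain u' w' where "(u', u) \<in> \<Union>\<C>" "(w', w) \<in> \<Union>\<C>"
      by blast
    then obtain X where "X \<in> \<C>" "(u', u) \<in> X" "(w', w) \<in> X"
      using common by blast
    then show "\<exists>D\<in>Range ` \<C>. path_connected_in E D \<and> u \<in> D \<and> w \<in> D"
      using iso unfolding partial_iso_def by blast
  qed
  then have "path_connected_in E (Range (\<Union>\<C>))"
    by (simp add: Range_Union)
  moreover have "\<Union>\<C> \<subseteq> V \<times> V"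
    using iso unfolding partial_iso_def by blast
  moreover have "(a = b \<longleftrightarrow> a' = b') \<and> (E a b \<longleftrightarrow> E a' b')"
    if ab: "(a, a') \<in> \<Union>\<C>" "(b, b') \<in> \<Union>\<C>" for a a' b b'
  proof -
    obtain X where "X \<in> \<C>" "(a, a') \<in> X" "(b, b') \<in> X"
      using common[OF ab] by blast
    then show ?thesis
      using iso[of X] unfolding partial_iso_def by blast
  qed
  moreover have "lab a = lab a'" if "(a, a') \<in> \<Union>\<C>" for a a'
    using iso that unfolding partial_iso_def by blast
  ultimately show ?thesis
    unfolding partial_iso_def by blast
qed

context graph_tree
begin

text \<open>
  The new vertices are leaves attached at \<open>w\<close> and \<open>w'\<close>: they have no other neighbour in
  the domain and the range, so adjacency is preserved automatically.
\<close>

lemma partial_iso_insert: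
  assumes F: "partial_iso V E lab F" and ww: "(w, w') \<in> F"
    and z: "z \<notin> Domain F" "E w z" and z': "z' \<notin> Range F" "E w' z'" and lab: "lab z = lab z'"
  shows "partial_iso V E lab (insert (z, z') F)"
proof -
  have sub: "F \<subseteq> V \<times> V" and conn: "path_connected_in E (Domain F)" "path_connected_in E (Range F)"
    and rel: "\<And>a a' b b'. (a, a') \<in> F \<Longrightarrow> (b, b') \<in> F \<Longrightarrow> (a = b \<longleftrightarrow> a' = b') \<and> (E a b \<longleftrightarrow> E a' b')"
    using F unfolding partial_iso_def by blast+
  have "E z a \<longleftrightarrow> a = w" if "a \<in> Domain F" for a
    using unique_neighbour_in_connected[OF conn(1) _ z(1), of a w] sub ww z that adj_sym by blast
  moreover have "E z' a' \<longleftrightarrow> a' = w'" if "a' \<in> Range F" for a'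
    using unique_neighbour_in_connected[OF conn(2) _ z'(1), of a' w'] sub ww z' that adj_sym by blast
  ultimately have new: "a \<noteq> z \<and> a' \<noteq> z' \<and> (E z a \<longleftrightarrow> E z' a') \<and> (E a z \<longleftrightarrow> E a' z')"
    if "(a, a') \<in> F" for a a'
    using that rel[OF that ww] z z' adj_sym by (metis Domain.DomainI Range.intros)
  have "path_connected_in E (Domain (insert (z, z') F))"
    using path_connected_in_insert[OF conn(1) _ z] ww by auto
  moreover have "path_connected_in E (Range (insert (z, z') F))"
    using path_connected_in_insert[OF conn(2) _ z'] ww by auto
  moreover have "(a = b \<longleftrightarrow> a' = b') \<and> (E a b \<longleftrightarrow> E a' b')"
    if "(a, a') \<in> insert (z, z') F" "(b, b') \<in> insert (z, z') F" for a a' b b'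
    using that rel[of a a' b b'] new[of a a'] new[of b b'] adj_irrefl by auto
  moreover have "insert (z, z') F \<subseteq> V \<times> V"
    using sub z(2) z'(2) adj_in_V by auto
  moreover have "\<forall>a a'. (a, a') \<in> insert (z, z') F \<longrightarrow> lab a = lab a'"
    using F lab unfolding partial_iso_def by blast
  ultimately show ?thesis
    unfolding partial_iso_def by blast
qed

text \<open>
  Paths in a tree have no chords, which would be needed to check adjacency directly. Adding the
  vertices from the far end one at a time, each as a leaf, hides this in the previous lemma.
\<close>

lemma partial_iso_zip_paths:
  assumes "is_path V E p" "is_path V E q" "map lab p = map lab q"
  shows "partial_iso V E lab (set (zip p q))"
proof -
  have "length p = length q"
    using assms(3) by (metis length_map)
  then show ?thesis
    using assms
  proof (induction p q rule: list_induct2)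
    case Nil
    then show ?case
      by (simp add: is_path_def)
  next
    case (Cons x p y q)
    show ?case
    proof (cases p)
      case Nil
      have single: "path_connected_in E {t}" for t
        unfolding path_connected_in_def is_path_between_def is_path_def
        by (intro ballI exI[of _ "[t]"]) auto
      show ?thesis
        using Nil Cons adj_irrefl single by (auto simp: partial_iso_def is_path_def)
    next
      case (Cons w p')
      then obtain w' q' where q: "q = w' # q'"
        using Cons.hyps by (cases q) auto
      have F: "partial_iso V E lab (set (zip p q))"
        using Cons.IH Cons.prems Cons q by (auto simp: is_path_def)
      have "E x w" "E y w'"
        using Cons.prems Cons q by (auto simp: is_path_def)
      moreover have "x \<notin> Domain (set (zip p q))" "y \<notin> Range (set (zip p q))"
        using Cons.prems by (auto simp: is_path_def dest: set_zip_leftD set_zip_rightD)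
      moreover have "(w, w') \<in> set (zip p q)" "lab x = lab y"
        using Cons q Cons.prems by auto
      ultimately show ?thesis
        using partial_iso_insert[OF F] adj_sym by simp
    qed
  qed
qed

end

section \<open>Extending partial isomorphisms to automorphisms\<close>

lemma count_image_mset_set:
  assumes "finite S"
  shows "count (image_mset f (mset_set S)) c = card {x \<in> S. f x = c}"
proof -
  have "count (image_mset f (mset_set S)) c = size (filter_mset (\<lambda>x. f x = c) (mset_set S))"
    by (simp add: count_conv_size_mset filter_mset_image_mset)
  also have "\<dots> = card {x \<in> S. f x = c}"
    using assms by (simp add: filter_mset_mset_set)
  finally show ?thesis .
qed

context label_regular_tree
begin

text \<open>
  The heart of the construction. Choose an edge from \<open>w\<close> in the domain to a vertex \<open>z\<close> outside. The
  matched neighbours of \<open>w\<close> with the label of \<open>z\<close> correspond to the matched neighbours of the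
  image \<open>w'\<close> with that label. By label-regularity \<open>w\<close> and \<open>w'\<close> have equally many
  neighbours with that label, finitely many, and \<open>z\<close> is unmatched; so some such neighbour of \<open>w'\<close>
  is unmatched as well, and it can serve as the image of \<open>z\<close>.
\<close>

lemma maximal_partial_iso_Domain:
  assumes F: "partial_iso V E lab F" and ne: "F \<noteq> {}"
    and max: "\<And>F'. partial_iso V E lab F' \<Longrightarrow> F \<subseteq> F' \<Longrightarrow> F' = F"
  shows "Domain F = V"
proof (rule ccontr)
  have sub: "F \<subseteq> V \<times> V"
    and rel: "\<And>a a' b b'. (a, a') \<in> F \<Longrightarrow> (b, b') \<in> F \<Longrightarrow> (a = b \<longleftrightarrow> a' = b') \<and> (E a b \<longleftrightarrow> E a' b')"
    and labF: "\<And>a a'. (a, a') \<in> F \<Longrightarrow> lab a = lab a'"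
    using F unfolding partial_iso_def by blast+
  assume "Domain F \<noteq> V"
  then obtain d x where d: "d \<in> Domain F" "d \<in> V" "x \<in> V" "x \<notin> Domain F"
    using sub ne by fastforce
  obtain p where "is_path_between V E d p x"
    using connected d by blast
  then have "successively E p" "p \<noteq> []" "hd p \<in> Domain F" "last p \<notin> Domain F"
    using d by (simp_all add: is_path_between_def is_path_def)
  then obtain w z where w: "w \<in> Domain F" and z: "z \<notin> Domain F" and wz: "E w z"
    by (rule exists_edge_leaving)
  obtain w' where ww: "(w, w') \<in> F"
    using w by blast
  have inV: "w \<in> V" "w' \<in> V"
    using ww sub by auto
  let ?N = "{y \<in> nbrs V E w. lab y = lab z}" and ?N' = "{y \<in> nbrs V E w'. lab y = lab z}"
  have "image_mset lab (mset_set (nbrs V E w)) = image_mset lab (mset_set (nbrs V E w'))"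
    using regular inV labF[OF ww] unfolding label_regular_def by blast
  then have card_eq: "card ?N = card ?N'"
    using count_image_mset_set[of _ lab "lab z"] locally_finite inV by metis
  have finN: "finite ?N"
    using locally_finite inV by simp
  have zN: "z \<in> ?N"
    using wz adj_in_V by (auto simp: nbrs_def)
  \<comment> \<open>otherwise the inverse of \<open>F\<close> injects \<open>?N'\<close> into \<open>?N\<close> without \<open>z\<close>\<close>
  have "\<not> ?N' \<subseteq> Range F"
  proof
    assume "?N' \<subseteq> Range F"
    then have "\<forall>y\<in>?N'. \<exists>x. (x, y) \<in> F"
      by blast
    then obtain r where r: "\<And>y. y \<in> ?N' \<Longrightarrow> (r y, y) \<in> F"
      by metis
    have "inj_on r ?N'"
      by (rule inj_onI) (metis r rel)
    moreover have "r y \<in> ?N - {z}" if y: "y \<in> ?N'" for y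
      using r[OF y] y rel[OF ww r[OF y]] labF[OF r[OF y]] sub z by (auto simp: nbrs_def)
    ultimately have "card ?N' \<le> card (?N - {z})"
      using finN by (meson card_inj_on_le finite_Diff image_subsetI)
    also have "\<dots> < card ?N"
      using finN zN by (simp only: card_Diff1_less)
    finally show False
      using card_eq by simp
  qed
  then obtain z' where "z' \<in> ?N'" "z' \<notin> Range F"
    by blast
  then have z': "z' \<notin> Range F" "E w' z'" "lab z = lab z'"
    by (simp_all add: nbrs_def)
  have "insert (z, z') F = F"
    using max partial_iso_insert[OF F ww z wz z'] by blast
  then show False
    using z by blast
qed

lemma label_aut_of_total_partial_iso:
  assumes F: "partial_iso V E lab F" "Domain F = V" "Range F = V"
  obtains f where "f \<in> label_auts V E lab" "\<And>a b. (a, b) \<in> F \<Longrightarrow> f a = b"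
proof -
  have sub: "F \<subseteq> V \<times> V"
    and rel: "\<And>a a' b b'. (a, a') \<in> F \<Longrightarrow> (b, b') \<in> F \<Longrightarrow> (a = b \<longleftrightarrow> a' = b') \<and> (E a b \<longleftrightarrow> E a' b')"
    and labF: "\<And>a a'. (a, a') \<in> F \<Longrightarrow> lab a = lab a'"
    using F unfolding partial_iso_def by blast+
  have "\<forall>a\<in>V. \<exists>b. (a, b) \<in> F"
    using F(2) by blast
  then obtain f0 where f0: "\<And>a. a \<in> V \<Longrightarrow> (a, f0 a) \<in> F"
    by metis
  define f where "f = restrict f0 V"
  have f: "(a, f a) \<in> F" if "a \<in> V" for a
    using f0[OF that] that by (simp add: f_def)
  have fF: "f a = b" if "(a, b) \<in> F" for a b
    using that f rel sub by blast
  have "inj_on f V"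
    by (rule inj_onI) (metis f rel)
  moreover have "f ` V = V"
  proof (intro equalityI subsetI)
    fix b assume "b \<in> V"
    then obtain a where "(a, b) \<in> F"
      using F(3) by blast
    then show "b \<in> f ` V"
      using fF sub by blast
  qed (use f sub in blast)
  ultimately have "f \<in> Bij V"
    by (auto simp: Bij_def bij_betw_def f_def)
  moreover have "\<forall>u\<in>V. \<forall>w\<in>V. E (f u) (f w) \<longleftrightarrow> E u w"
    using f rel by blast
  moreover have "\<forall>u\<in>V. lab (f u) = lab u"
    using f labF by metis
  ultimately have "f \<in> label_auts V E lab"
    by (simp add: label_auts_def)
  then show thesis
    using that fF by blast
qed

lemma partial_iso_extends:
  assumes F0: "partial_iso V E lab F0" "F0 \<noteq> {}"
  obtains f where "f \<in> label_auts V E lab" "\<And>a b. (a, b) \<in> F0 \<Longrightarrow> f a = b"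
proof -
  let ?A = "{F. partial_iso V E lab F \<and> F0 \<subseteq> F}"
  have "\<exists>M\<in>?A. \<forall>X\<in>?A. M \<subseteq> X \<longrightarrow> X = M"
  proof (rule subset_Zorn_nonempty)
    fix \<C> assume ne: "\<C> \<noteq> {}" and ch: "subset.chain ?A \<C>"
    have "subset.chain {F. partial_iso V E lab F} \<C>"
      using ch by (auto simp: subset.chain_def)
    moreover have "F0 \<subseteq> \<Union>\<C>"
    proof -
      obtain X where "X \<in> \<C>"
        using ne by blast
      then have "F0 \<subseteq> X"
        using ch by (auto simp: subset.chain_def)
      then show ?thesis
        using \<open>X \<in> \<C>\<close> by (rule Sup_upper2[rotated])
    qed
    ultimately show "\<Union>\<C> \<in> ?A"
      using partial_iso_Union_chain by blast
  qed (use F0 in blast)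
  then obtain F where "F \<in> ?A" and max_A: "\<forall>X\<in>?A. F \<subseteq> X \<longrightarrow> X = F"
    by (rule bexE)
  then have F: "partial_iso V E lab F" "F0 \<subseteq> F"
    by simp_all
  have max: "F' = F" if "partial_iso V E lab F'" "F \<subseteq> F'" for F'
    using max_A that F(2) by simp
  have "F \<noteq> {}"
    using F F0 by blast
  then have D: "Domain F = V"
    using maximal_partial_iso_Domain F(1) max by blast
  \<comment> \<open>the converse of a maximal partial isomorphism is maximal, so \<open>F\<close> is also onto\<close>
  have "Domain (F\<inverse>) = V"
  proof (rule maximal_partial_iso_Domain)
    fix F' assume "partial_iso V E lab F'" "F\<inverse> \<subseteq> F'"
    then have "F'\<inverse> = F"
      using max[of "F'\<inverse>"] partial_iso_converse[of V E lab F'] by (metis converse_converse converse_mono)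
    then show "F' = F\<inverse>"
      by auto
  qed (use F(1) \<open>F \<noteq> {}\<close> in \<open>auto simp: partial_iso_converse\<close>)
  then have "Range F = V"
    by simp
  then show thesis
    using label_aut_of_total_partial_iso[OF F(1) D] that F(2) by (metis subsetD)
qed

text \<open>
  Taking \<open>u = u'\<close>, this says that the stabiliser of \<open>u\<close> acts transitively on the endpoints of
  paths from \<open>u\<close> with a given label sequence.
\<close>

lemma label_aut_mapping_path:
  assumes "is_path_between V E u p w" "is_path_between V E u' q w'" "map lab p = map lab q"
  obtains f where "f \<in> label_auts V E lab" "f u = u'" "f w = w'"
proof -
  have ne: "p \<noteq> []" "q \<noteq> []" and len: "length p = length q"
    using assms by (auto simp: is_path_between_def is_path_def dest: map_eq_imp_length_eq)
  then have iso: "partial_iso V E lab (set (zip p q))" "set (zip p q) \<noteq> {}"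
    using partial_iso_zip_paths assms by (auto simp: is_path_between_def neq_Nil_conv)
  have "(p ! i, q ! i) \<in> set (zip p q)" if "i < length p" for i
    using that len by (auto simp: set_zip)
  moreover have "u = p ! 0" "u' = q ! 0" "w = p ! (length p - 1)" "w' = q ! (length p - 1)"
    using assms ne len by (auto simp: is_path_between_def hd_conv_nth last_conv_nth)
  ultimately have "(u, u') \<in> set (zip p q)" "(w, w') \<in> set (zip p q)"
    using ne by auto
  then show thesis
    using partial_iso_extends[OF iso] that by metis
qed

section \<open>The automorphism group and its double cosets\<close>

lemma label_auts_subgroup: "subgroup (label_auts V E lab) (BijGroup V)"
proof (rule group.subgroupI[OF group_BijGroup])
  show "label_auts V E lab \<subseteq> carrier (BijGroup V)"
    by (auto simp: label_auts_def BijGroup_def)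
  have "(\<lambda>x\<in>V. x) \<in> label_auts V E lab"
    by (auto simp: label_auts_def id_Bij)
  then show "label_auts V E lab \<noteq> {}"
    by blast
next
  fix f assume f: "f \<in> label_auts V E lab"
  then have bij: "f \<in> Bij V"
    by (simp add: label_auts_def)
  have inV: "inv_into V f x \<in> V" "f (inv_into V f x) = x" if "x \<in> V" for x
    using bij that by (auto simp: Bij_def bij_betw_def inv_into_into f_inv_into_f)
  have "restrict (inv_into V f) V \<in> Bij V"
    using restrict_inv_into_Bij[OF bij] by simp
  moreover have "E (inv_into V f u) (inv_into V f w) \<longleftrightarrow> E u w" if "u \<in> V" "w \<in> V" for u w
    using f inV[OF that(1)] inV[OF that(2)] unfolding label_auts_def by fastforce
  moreover have "lab (inv_into V f u) = lab u" if "u \<in> V" for u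
    using f inV[OF that] unfolding label_auts_def by fastforce
  ultimately show "inv\<^bsub>BijGroup V\<^esub> f \<in> label_auts V E lab"
    by (simp add: inv_BijGroup[OF bij] label_auts_def)
next
  fix f g assume fg: "f \<in> label_auts V E lab" "g \<in> label_auts V E lab"
  then have bij: "f \<in> Bij V" "g \<in> Bij V"
    by (auto simp: label_auts_def)
  have "g x \<in> V" if "x \<in> V" for x
    using bij(2) that by (auto simp: Bij_def bij_betw_def)
  then show "f \<otimes>\<^bsub>BijGroup V\<^esub> g \<in> label_auts V E lab"
    using fg bij by (auto simp: BijGroup_def label_auts_def compose_Bij compose_eq)
qed

abbreviation (input) Aut :: "('v \<Rightarrow> 'v) monoid" where
  "Aut \<equiv> label_aut_group V E lab"

lemma group_Aut: "group Aut"
  using subgroup.subgroup_is_group[OF label_auts_subgroup group_BijGroup]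
  by (simp add: label_aut_group_def)

lemma carrier_Aut: "carrier Aut = label_auts V E lab"
  by (simp add: label_aut_group_def)

lemma Aut_in_V: "f \<in> carrier Aut \<Longrightarrow> x \<in> V \<Longrightarrow> f x \<in> V"
  by (auto simp: carrier_Aut label_auts_def Bij_def bij_betw_def)

lemma Aut_mult_apply:
  "f \<in> carrier Aut \<Longrightarrow> g \<in> carrier Aut \<Longrightarrow> x \<in> V \<Longrightarrow> (f \<otimes>\<^bsub>Aut\<^esub> g) x = f (g x)"
  by (simp add: carrier_Aut label_aut_group_def label_auts_def BijGroup_def compose_eq)

lemma Aut_one_apply: "x \<in> V \<Longrightarrow> \<one>\<^bsub>Aut\<^esub> x = x"
  by (simp add: label_aut_group_def BijGroup_def)

lemma Aut_inv_apply:
  assumes "f \<in> carrier Aut" "x \<in> V"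
  shows "(inv\<^bsub>Aut\<^esub> f) (f x) = x"
proof -
  interpret group Aut
    by (rule group_Aut)
  show ?thesis
    using Aut_mult_apply[OF inv_closed[OF assms(1)] assms] assms by (simp add: Aut_one_apply)
qed

lemma Aut_label_tree_path:
  assumes f: "f \<in> carrier Aut" and V: "u \<in> V" "w \<in> V"
  shows "map lab (tree_path V E (f u) (f w)) = map lab (tree_path V E u w)"
proof -
  let ?p = "tree_path V E u w"
  have p: "is_path_between V E u ?p w"
    by (rule tree_path_is_path[OF V])
  then have pV: "set ?p \<subseteq> V" "?p \<noteq> []"
    by (auto simp: is_path_between_def is_path_def)
  have "inj_on f V" and fE: "\<forall>u\<in>V. \<forall>w\<in>V. E (f u) (f w) \<longleftrightarrow> E u w" and fl: "\<forall>u\<in>V. lab (f u) = lab u"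
    using f by (auto simp: carrier_Aut label_auts_def Bij_def bij_betw_def)
  then have "distinct (map f ?p)"
    using p pV by (auto simp: is_path_between_def is_path_def distinct_map intro: inj_on_subset)
  moreover have "successively E (map f ?p)"
    using p pV fE unfolding successively_map is_path_between_def is_path_def
    by (metis (mono_tags, lifting) subsetD successively_mono)
  ultimately have "is_path_between V E (f u) (map f ?p) (f w)"
    using p pV Aut_in_V[OF f]
    by (auto simp: is_path_between_def is_path_def hd_map last_map)
  then have "tree_path V E (f u) (f w) = map f ?p"
    by (rule tree_path_eqI)
  then show ?thesis
    using fl pV by auto
qed

lemma double_coset_eq:
  "double_coset H K g = {k \<otimes>\<^bsub>H\<^esub> g \<otimes>\<^bsub>H\<^esub> k' |k k'. k \<in> K \<and> k' \<in> K}"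
  by (auto simp: double_coset_def set_mult_def)

text \<open>
  The label sequence from \<open>v\<close> to \<open>h v\<close> is a complete invariant of double cosets. For
  completeness, an element \<open>k\<close> of the stabiliser with \<open>k (g v) = h v\<close> leaves \<open>(k g)\<inverse> h\<close> as
  the right-hand factor.
\<close>

lemma double_coset_eq_label_path_class:
  assumes v: "v \<in> V" and K: "K = {g \<in> carrier Aut. g v = v}"
    and g: "g \<in> carrier Aut"
  shows "double_coset Aut K g =
    {h \<in> carrier Aut. map lab (tree_path V E v (h v)) = map lab (tree_path V E v (g v))}"
proof (intro equalityI subsetI)
  interpret group Aut
    by (rule group_Aut)
  fix h assume "h \<in> double_coset Aut K g"
  then obtain k k' where k: "k \<in> carrier Aut" "k v = v" "k' \<in> carrier Aut" "k' v = v"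
    and h: "h = k \<otimes>\<^bsub>Aut\<^esub> g \<otimes>\<^bsub>Aut\<^esub> k'"
    by (auto simp: double_coset_eq K)
  have "h v = k (g v)"
    using k g v by (simp add: h Aut_mult_apply Aut_in_V)
  then show "h \<in> {h \<in> carrier Aut. map lab (tree_path V E v (h v)) = map lab (tree_path V E v (g v))}"
    using Aut_label_tree_path[OF k(1) v Aut_in_V[OF g v]] k g h by simp
next
  interpret group Aut
    by (rule group_Aut)
  fix h assume "h \<in> {h \<in> carrier Aut. map lab (tree_path V E v (h v)) = map lab (tree_path V E v (g v))}"
  then have h: "h \<in> carrier Aut"
    and eq: "map lab (tree_path V E v (g v)) = map lab (tree_path V E v (h v))"
    by auto
  obtain k where k: "k \<in> carrier Aut" "k v = v" "k (g v) = h v"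
    using label_aut_mapping_path[OF tree_path_is_path tree_path_is_path eq] v g h
    by (metis Aut_in_V carrier_Aut)
  let ?k' = "inv\<^bsub>Aut\<^esub> (k \<otimes>\<^bsub>Aut\<^esub> g) \<otimes>\<^bsub>Aut\<^esub> h"
  have kg: "k \<otimes>\<^bsub>Aut\<^esub> g \<in> carrier Aut"
    using k g by simp
  have "h v = (k \<otimes>\<^bsub>Aut\<^esub> g) v"
    using k g v by (simp add: Aut_mult_apply)
  then have "?k' v = v"
    using Aut_inv_apply[OF kg v] Aut_mult_apply[OF inv_closed[OF kg] h v] by simp
  then have "?k' \<in> K" "k \<in> K"
    using k h kg by (auto simp: K)
  moreover have "h = k \<otimes>\<^bsub>Aut\<^esub> g \<otimes>\<^bsub>Aut\<^esub> ?k'"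
    using kg h by (simp add: m_assoc[symmetric])
  ultimately show "h \<in> double_coset Aut K g"
    unfolding double_coset_eq by blast
qed

text \<open>
  A path witnessing compatibility starts at some vertex with the label of \<open>v\<close>, not
  necessarily at \<open>v\<close>; transitivity on label classes moves its start to \<open>v\<close>, and then provides an
  automorphism taking \<open>v\<close> to its other end.
\<close>

lemma loop_label_seq_realised:
  assumes v: "v \<in> V" and "\<alpha> \<in> loop_label_seqs V E lab C v"
  shows "\<exists>w g. admissible_choice V E lab v \<alpha> w g"
proof -
  obtain p where p: "is_path V E p" "map lab p = \<alpha>" and \<alpha>: "hd \<alpha> = lab v" "last \<alpha> = lab v"
    using assms by (auto simp: loop_label_seqs_def compatible_def)
  let ?x = "hd p" and ?y = "last p"
  have ne: "p \<noteq> []"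
    using p by (simp add: is_path_def)
  then have V: "?x \<in> V" "?y \<in> V"
    using p by (auto simp: is_path_def)
  have lab: "lab ?x = lab v" "lab ?y = lab v"
    using \<alpha> p(2) ne by (auto simp: hd_map last_map)
  have trans: "\<exists>g\<in>carrier Aut. g u = w" if "u \<in> V" "w \<in> V" "lab u = lab w" for u w
    using normal that unfolding normal_labelling_def by (metis imageI)
  obtain f where f: "f \<in> carrier Aut" "f ?x = v"
    using trans[OF V(1) v lab(1)] by blast
  have fy: "f ?y \<in> V" "lab (f ?y) = lab v"
    using f V lab Aut_in_V by (auto simp: carrier_Aut label_auts_def)
  obtain g where g: "g \<in> carrier Aut" "g v = f ?y"
    using trans[OF v fy(1)] fy(2) by metis
  have "tree_path V E ?x ?y = p"
    using p by (intro tree_path_eqI) (simp add: is_path_between_def)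
  then have "map lab (tree_path V E v (f ?y)) = \<alpha>"
    using Aut_label_tree_path[OF f(1) V] f(2) p(2) by simp
  then have "admissible_choice V E lab v \<alpha> (f ?y) g"
    using g fy by (simp add: admissible_choice_def)
  then show ?thesis
    by blast
qed

lemma label_path_in_loop_label_seqs:
  assumes v: "v \<in> V" and h: "h \<in> carrier Aut"
  shows "map lab (tree_path V E v (h v)) \<in> loop_label_seqs V E lab C v"
proof -
  have p: "is_path_between V E v (tree_path V E v (h v)) (h v)"
    using tree_path_is_path v h Aut_in_V by blast
  moreover have "lab (h v) = lab v"
    using h v by (auto simp: carrier_Aut label_auts_def)
  moreover have "lab ` V = C"
    using normal by (simp add: normal_labelling_def)
  ultimately show ?thesis
    by (auto simp: loop_label_seqs_def compatible_def is_path_between_def is_path_def hd_map last_map)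
qed

end

section \<open>The double coset decomposition\<close>

theorem theorem3p1:
  fixes V :: "'v set" and E :: "'v \<Rightarrow> 'v \<Rightarrow> bool" and lab :: "'v \<Rightarrow> 'c" and C :: "'c set"
    and v :: 'v and G :: "('v \<Rightarrow> 'v) monoid" and K :: "('v \<Rightarrow> 'v) set" and A :: "'c list set"
  assumes "label_regular_tree V E lab C"
    and "v \<in> V"
    and "G = label_aut_group V E lab"
    and "K = {g \<in> carrier G. g v = v}"
    and "A = loop_label_seqs V E lab C v"
  shows "(\<forall>\<alpha>\<in>A. \<exists>w g. admissible_choice V E lab v \<alpha> w g) \<and>
    (\<forall>(v' :: 'c list \<Rightarrow> 'v) (g' :: 'c list \<Rightarrow> 'v \<Rightarrow> 'v).
       (\<forall>\<alpha>\<in>A. admissible_choice V E lab v \<alpha> (v' \<alpha>) (g' \<alpha>)) \<longrightarrow>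
         disjoint_family_on (\<lambda>\<alpha>. double_coset G K (g' \<alpha>)) A \<and>
         carrier G = (\<Union>\<alpha>\<in>A. double_coset G K (g' \<alpha>)))"
proof -
  interpret label_regular_tree V E lab C
    by (rule assms(1))
  \<comment> \<open>the complete invariant of double cosets\<close>
  let ?type = "\<lambda>h. map lab (tree_path V E v (h v))"
  have "disjoint_family_on (\<lambda>\<alpha>. double_coset G K (g' \<alpha>)) A \<and>
      carrier G = (\<Union>\<alpha>\<in>A. double_coset G K (g' \<alpha>))"
    if choice: "\<forall>\<alpha>\<in>A. admissible_choice V E lab v \<alpha> (v' \<alpha>) (g' \<alpha>)" for v' g'
  proof -
    have coset: "double_coset G K (g' \<alpha>) = {h \<in> carrier G. ?type h = \<alpha>}" if "\<alpha> \<in> A" for \<alpha>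
      using choice that double_coset_eq_label_path_class[of v K "g' \<alpha>"] assms(2-4)
      by (auto simp: admissible_choice_def)
    have "?type h \<in> A" if "h \<in> carrier G" for h
      using label_path_in_loop_label_seqs assms that by simp
    then show ?thesis
      using coset by (auto simp: disjoint_family_on_def)
  qed
  then show ?thesis
    using loop_label_seq_realised assms(2,5) by blast
qed

end
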